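(* Let $X$ be the real vector space of $3\times3$ real matrices $C$, with the action of $G=\operatorname{SO}_3(\mathbb{R})\times\operatorname{SO}_3(\mathbb{R})$ given by $(R_1,R_2)\cdot C=R_1CR_2^t$, and let $$t_2=\operatorname{tr}(CC^t),\qquad t_3=\det C,\qquad t_4=\operatorname{tr}\big((CC^t)^2\big).$$ Then the ring of invariants $\mathbb{R}[X]^G$ (the ring of invariants of locally maximally mixed states of two qubits) is the polynomial ring $\mathbb{R}[t_2,t_3,t_4]$, where each $t_i$ is graded in degree $i$, $i=2,3,4$.
   Context: The space $X$ is the Bloch matrix model of the variety of locally maximally mixed states of two qubits: such a state is represented by the $3\times 3$ matrix $C$ of its 2-point correlation functions, and local unitary operators act through the action of $G=\operatorname{SO}_3(\mathbb{R})\times\operatorname{SO}_3(\mathbb{R})$ on $X$ given by $(R_1,R_2)\cdot C=R_1CR_2^t$. $\mathbb{R}[X]$ is the ring of real polynomial functions in the nine entries of $C$, graded by polynomial degree, and $\mathbb{R}[X]^G$ is the subring of polynomials $f$ with $f(gx)=f(x)$ for all $g\in G$, $x\in X$. *)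

theory Defs
  imports
    "HOL-Analysis.Analysis"
    "HOL-Library.Poly_Mapping"
    "HOL-Algebra.QuotRing"
    "HOL-Algebra.Algebraic_Closure_Type"
begin

unbundle no fps_syntax  (* the $ of power series clashes with vector components *)

text \<open>Finitely supported families of real coefficients indexed by finitely supported exponent
  vectors; the ring operations are those of \<^theory>\<open>HOL-Library.Poly_Mapping\<close> (convolution product).\<close>

type_synonym 'v mpoly = "('v \<Rightarrow>\<^sub>0 nat) \<Rightarrow>\<^sub>0 real"

definition mconst :: "real \<Rightarrow> 'v mpoly" where
  "mconst c = Poly_Mapping.single 0 c"

definition mvar :: "'v \<Rightarrow> 'v mpoly" where
  "mvar v = Poly_Mapping.single (Poly_Mapping.single v 1) 1"

definition meval :: "'v mpoly \<Rightarrow> ('v \<Rightarrow> real) \<Rightarrow> real" where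
  "meval p x = (\<Sum>m\<in>Poly_Mapping.keys p.
     Poly_Mapping.lookup p m * (\<Prod>v\<in>Poly_Mapping.keys m. x v ^ Poly_Mapping.lookup m v))"

text \<open>Homogeneous polynomials of degree \<open>d\<close>, where the indeterminate \<open>v\<close> is placed in degree \<open>w v\<close>;
  the zero polynomial belongs to every degree.\<close>

definition mhomogeneous :: "('v \<Rightarrow> nat) \<Rightarrow> nat \<Rightarrow> 'v mpoly set" where
  "mhomogeneous w d = {p. \<forall>m\<in>Poly_Mapping.keys p.
     (\<Sum>v\<in>Poly_Mapping.keys m. w v * Poly_Mapping.lookup m v) = d}"

type_synonym bloch = "real ^ 3 ^ 3"

definition entries :: "bloch \<Rightarrow> 3 \<times> 3 \<Rightarrow> real" where
  "entries C = (\<lambda>(i, j). C $ i $ j)"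

definition polynomial_functions :: "(bloch \<Rightarrow> real) set" where
  "polynomial_functions = range (\<lambda>(p :: (3 \<times> 3) mpoly) C. meval p (entries C))"

definition polynomial_functions_deg :: "nat \<Rightarrow> (bloch \<Rightarrow> real) set" where
  "polynomial_functions_deg d =
     (\<lambda>(p :: (3 \<times> 3) mpoly) C. meval p (entries C)) ` mhomogeneous (\<lambda>_. 1) d"

definition SO3 :: "(real ^ 3 ^ 3) set" where
  "SO3 = {R. rotation_matrix R}"

definition act :: "(real ^ 3 ^ 3) \<times> (real ^ 3 ^ 3) \<Rightarrow> bloch \<Rightarrow> bloch" where
  "act = (\<lambda>(R1, R2) C. R1 ** C ** transpose R2)"

definition invariants :: "(bloch \<Rightarrow> real) set" where
  "invariants = {f \<in> polynomial_functions. \<forall>g \<in> SO3 \<times> SO3. \<forall>C. f (act g C) = f C}"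

definition invariant_ring :: "(bloch \<Rightarrow> real) ring" where
  "invariant_ring = \<lparr>carrier = invariants,
     monoid.mult = (\<lambda>f g C. f C * g C), one = (\<lambda>C. 1),
     zero = (\<lambda>C. 0), add = (\<lambda>f g C. f C + g C)\<rparr>"

datatype gen = T2 | T3 | T4

fun gen_deg :: "gen \<Rightarrow> nat" where
  "gen_deg T2 = 2" | "gen_deg T3 = 3" | "gen_deg T4 = 4"

fun gen_fun :: "gen \<Rightarrow> bloch \<Rightarrow> real" where
  "gen_fun T2 C = trace (C ** transpose C)"
| "gen_fun T3 C = det C"
| "gen_fun T4 C = trace ((C ** transpose C) ** (C ** transpose C))"

definition subst_gens :: "gen mpoly \<Rightarrow> bloch \<Rightarrow> real" where
  "subst_gens p = (\<lambda>C. meval p (\<lambda>t. gen_fun t C))"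

lemma meval_superset:
  assumes "finite A" "Poly_Mapping.keys p \<subseteq> A"
  shows "meval p x = (\<Sum>m\<in>A. Poly_Mapping.lookup p m *
           (\<Prod>v\<in>Poly_Mapping.keys m. x v ^ Poly_Mapping.lookup m v))"
  unfolding meval_def
  by (rule sum.mono_neutral_left) (use assms in \<open>auto simp: in_keys_iff\<close>)

lemma meval_single:
  "meval (Poly_Mapping.single m c) x =
     c * (\<Prod>v\<in>Poly_Mapping.keys m. x v ^ Poly_Mapping.lookup m v)"
  by (cases "c = 0") (simp_all add: meval_def)

lemma meval_mconst [simp]: "meval (mconst c) x = c"
  by (simp add: mconst_def meval_single)

lemma meval_mvar [simp]: "meval (mvar v) x = x v"
  by (simp add: mvar_def meval_single)

lemma meval_zero [simp]: "meval 0 x = 0"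
  by (simp add: meval_def)

lemma meval_one [simp]: "meval 1 x = 1"
  using meval_mconst[of 1 x] by (simp add: mconst_def)

lemma meval_add: "meval (p + q) x = meval p x + meval q x"
proof -
  let ?A = "Poly_Mapping.keys p \<union> Poly_Mapping.keys q"
  have "finite ?A" by simp
  then show ?thesis
    using Poly_Mapping.keys_add[of p q]
    by (simp add: meval_superset[of ?A] lookup_add distrib_right sum.distrib)
qed

lemma monom_eval_superset:
  assumes "finite A" "Poly_Mapping.keys m \<subseteq> A"
  shows "(\<Prod>v\<in>Poly_Mapping.keys m. (x v :: real) ^ Poly_Mapping.lookup m v) =
         (\<Prod>v\<in>A. x v ^ Poly_Mapping.lookup m v)"
  by (rule prod.mono_neutral_left) (use assms in \<open>auto simp: in_keys_iff\<close>)

lemma monom_eval_add: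
  "(\<Prod>v\<in>Poly_Mapping.keys (m + n). (x v :: real) ^ Poly_Mapping.lookup (m + n) v) =
   (\<Prod>v\<in>Poly_Mapping.keys m. x v ^ Poly_Mapping.lookup m v) *
   (\<Prod>v\<in>Poly_Mapping.keys n. x v ^ Poly_Mapping.lookup n v)"
proof -
  let ?A = "Poly_Mapping.keys m \<union> Poly_Mapping.keys n"
  have "(\<Prod>v\<in>Poly_Mapping.keys (m + n). x v ^ Poly_Mapping.lookup (m + n) v) =
        (\<Prod>v\<in>?A. x v ^ Poly_Mapping.lookup (m + n) v)"
    by (rule monom_eval_superset) (use Poly_Mapping.keys_add[of m n] in auto)
  also have "\<dots> = (\<Prod>v\<in>?A. x v ^ Poly_Mapping.lookup m v) * (\<Prod>v\<in>?A. x v ^ Poly_Mapping.lookup n v)"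
    by (simp add: lookup_add power_add prod.distrib)
  finally show ?thesis
    by (simp add: monom_eval_superset[of ?A m] monom_eval_superset[of ?A n])
qed

lemma mpoly_induct [case_names zero add]:
  fixes p :: "'v mpoly"
  assumes "P 0" "\<And>q m c. P q \<Longrightarrow> P (Poly_Mapping.single m c + q)"
  shows "P p"
proof (induction p rule: Poly_Mapping.update_induct)
  case const
  then show ?case by fact
next
  case (update f a b)
  have "Poly_Mapping.update a b f = Poly_Mapping.single a b + f"
    using update
    by (intro poly_mapping_eqI) (auto simp: lookup_update lookup_add lookup_single in_keys_iff when_def)
  then show ?case using assms(2) update by simp
qed

lemma meval_mult: "meval (p * q) x = meval p x * meval q x"
proof (induction p rule: mpoly_induct)
  case zero
  then show ?case by simp
next
  case (add p m c)
  have "meval (Poly_Mapping.single m c * q) x = meval (Poly_Mapping.single m c) x * meval q x"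
    by (induction q rule: mpoly_induct)
       (simp_all add: distrib_left meval_add mult_single meval_single monom_eval_add algebra_simps)
  with add show ?case by (simp add: distrib_right meval_add)
qed

lemma polynomial_functionsI: "f = (\<lambda>C. meval p (entries C)) \<Longrightarrow> f \<in> polynomial_functions"
  by (auto simp: polynomial_functions_def)

lemma polynomial_functions_const: "(\<lambda>C. c) \<in> polynomial_functions"
  by (rule polynomial_functionsI[of _ "mconst c"]) simp

lemma polynomial_functions_entry: "(\<lambda>C. C $ i $ j) \<in> polynomial_functions"
  by (rule polynomial_functionsI[of _ "mvar (i, j)"]) (simp add: entries_def)

lemma polynomial_functions_add:
  "f \<in> polynomial_functions \<Longrightarrow> g \<in> polynomial_functions \<Longrightarrow> (\<lambda>C. f C + g C) \<in> polynomial_functions"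
  by (auto simp: polynomial_functions_def meval_add[symmetric])

lemma polynomial_functions_mult:
  "f \<in> polynomial_functions \<Longrightarrow> g \<in> polynomial_functions \<Longrightarrow> (\<lambda>C. f C * g C) \<in> polynomial_functions"
  by (auto simp: polynomial_functions_def meval_mult[symmetric])

lemma polynomial_functions_sum:
  "(\<And>i. i \<in> A \<Longrightarrow> f i \<in> polynomial_functions) \<Longrightarrow> (\<lambda>C. \<Sum>i\<in>A. f i C) \<in> polynomial_functions"
  by (induction A rule: infinite_finite_induct)
     (auto intro: polynomial_functions_const polynomial_functions_add)

lemma polynomial_functions_iff: "f \<in> polynomial_functions \<longleftrightarrow> real_polynomial_function f"
proof
  assume "f \<in> polynomial_functions"
  then obtain p :: "(3 \<times> 3) mpoly" where f: "f = (\<lambda>C. meval p (entries C))"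
    by (auto simp: polynomial_functions_def)
  have e: "real_polynomial_function (\<lambda>C. entries C v)" for v
  proof (rule real_polynomial_function.intros(1))
    show "bounded_linear (\<lambda>C. entries C v)"
      by (cases v) (simp add: entries_def linear_conv_bounded_linear[symmetric] linear_iff)
  qed
  have "real_polynomial_function (\<lambda>C. \<Prod>v\<in>A. entries C v ^ k v)" for A and k :: "_ \<Rightarrow> nat"
    by (induction A rule: infinite_finite_induct) (auto intro!: real_polynomial_function_power e)
  then show "real_polynomial_function f"
    unfolding f meval_def by (intro real_polynomial_function_sum) auto
next
  assume "real_polynomial_function f"
  then show "f \<in> polynomial_functions"
  proof induction
    case (linear f)
    then have lin: "linear f" by (simp add: linear_conv_bounded_linear)
    have "f C = (\<Sum>i\<in>UNIV. \<Sum>j\<in>UNIV. f (axis i (axis j 1)) * C $ i $ j)" for C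
    proof -
      have "C = (\<Sum>i\<in>UNIV. \<Sum>j\<in>UNIV. (C $ i $ j) *\<^sub>R axis i (axis j 1))"
        by (simp add: vec_eq_iff sum_3 forall_3 axis_def)
      then have "f C = f (\<Sum>i\<in>UNIV. \<Sum>j\<in>UNIV. (C $ i $ j) *\<^sub>R axis i (axis j 1))" by simp
      also have "\<dots> = (\<Sum>i\<in>UNIV. \<Sum>j\<in>UNIV. f (axis i (axis j 1)) * C $ i $ j)"
        by (simp add: linear_sum[OF lin] linear_cmul[OF lin] mult.commute)
      finally show ?thesis .
    qed
    then have *: "f = (\<lambda>C. \<Sum>i\<in>UNIV. \<Sum>j\<in>UNIV. f (axis i (axis j 1)) * C $ i $ j)"
      by (rule ext)
    show ?case
      by (subst *) (intro polynomial_functions_sum polynomial_functions_mult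
          polynomial_functions_const polynomial_functions_entry)
  qed (auto intro: polynomial_functions_const polynomial_functions_add polynomial_functions_mult)
qed

end

theory Submission
  imports Defs
begin

text \<open>
  By the singular value decomposition every matrix is equivalent under the group to a diagonal
  one, so an invariant is determined by its restriction to diagonal matrices
  \<open>diag(a, b, c)\<close>. That restriction is fixed by permutations and by even sign changes, hence equals
  its average over this group of order 24. The average of a monomial is either zero or a power
  of \<open>abc\<close> times a symmetrised monomial in \<open>a\<^sup>2, b\<^sup>2, c\<^sup>2\<close>, and
  Newton's identities express the latter through \<open>t\<^sub>2\<close>, \<open>t\<^sub>4\<close> and \<open>t\<^sub>3\<^sup>2\<close>. The three generators are
  algebraically independent because their values on diagonal matrices fill a box.
\<close>

section \<open>Polynomials\<close>

lemma meval_sum: "meval (\<Sum>i\<in>A. p i) x = (\<Sum>i\<in>A. meval (p i) x)"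
  by (induction A rule: infinite_finite_induct) (simp_all add: meval_add)

lemma weighted_degree_superset:
  fixes w :: "'v \<Rightarrow> nat"
  assumes "finite A" "Poly_Mapping.keys m \<subseteq> A"
  shows "(\<Sum>v\<in>Poly_Mapping.keys m. w v * Poly_Mapping.lookup m v)
    = (\<Sum>v\<in>A. w v * Poly_Mapping.lookup m v)"
  by (rule sum.mono_neutral_left) (use assms in \<open>auto simp: in_keys_iff\<close>)

lemma weighted_degree_add:
  fixes w :: "'v \<Rightarrow> nat"
  shows "(\<Sum>v\<in>Poly_Mapping.keys (m + n). w v * Poly_Mapping.lookup (m + n) v)
    = (\<Sum>v\<in>Poly_Mapping.keys m. w v * Poly_Mapping.lookup m v)
      + (\<Sum>v\<in>Poly_Mapping.keys n. w v * Poly_Mapping.lookup n v)"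
proof -
  let ?A = "Poly_Mapping.keys m \<union> Poly_Mapping.keys n"
  have "(\<Sum>v\<in>Poly_Mapping.keys (m + n). w v * Poly_Mapping.lookup (m + n) v)
    = (\<Sum>v\<in>?A. w v * Poly_Mapping.lookup (m + n) v)"
    by (rule weighted_degree_superset) (use Poly_Mapping.keys_add[of m n] in auto)
  then show ?thesis
    by (simp add: weighted_degree_superset[of ?A m] weighted_degree_superset[of ?A n]
        lookup_add distrib_left sum.distrib)
qed

lemma mhomogeneous_zero: "0 \<in> mhomogeneous w d"
  by (simp add: mhomogeneous_def)

lemma mhomogeneous_add:
  "p \<in> mhomogeneous w d \<Longrightarrow> q \<in> mhomogeneous w d \<Longrightarrow> p + q \<in> mhomogeneous w d"
  using Poly_Mapping.keys_add[of p q] by (fastforce simp: mhomogeneous_def)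

lemma mhomogeneous_sum:
  "(\<And>i. i \<in> A \<Longrightarrow> p i \<in> mhomogeneous w d) \<Longrightarrow> (\<Sum>i\<in>A. p i) \<in> mhomogeneous w d"
  by (induction A rule: infinite_finite_induct) (auto intro: mhomogeneous_zero mhomogeneous_add)

lemma mhomogeneous_mult:
  assumes "p \<in> mhomogeneous w d" "q \<in> mhomogeneous w e"
  shows "p * q \<in> mhomogeneous w (d + e)"
  using assms keys_mult[of p q] by (fastforce simp: mhomogeneous_def weighted_degree_add)

lemma mhomogeneous_mconst: "mconst c \<in> mhomogeneous w 0"
  by (simp add: mhomogeneous_def mconst_def)

lemma mhomogeneous_mvar: "mvar v \<in> mhomogeneous w (w v)"
  by (simp add: mhomogeneous_def mvar_def)

section \<open>Polynomials vanishing on products of infinite sets\<close>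

text \<open>Induction on the variables: with all other coordinates frozen, the sum is a univariate
  polynomial in the new one with infinitely many roots, so its coefficients vanish, and each of them
  is a sum of the same shape in fewer variables. Exponents are plain functions that need only be
  told apart on \<open>V\<close>, because the induction shrinks \<open>V\<close>.\<close>

lemma multivariate_identity_coeff:
  fixes c :: "('v \<Rightarrow> nat) \<Rightarrow> real" and S :: "'v \<Rightarrow> real set"
  assumes "finite V" "finite M" "\<And>v. v \<in> V \<Longrightarrow> infinite (S v)"
    and "\<And>m n. m \<in> M \<Longrightarrow> n \<in> M \<Longrightarrow> (\<And>v. v \<in> V \<Longrightarrow> m v = n v) \<Longrightarrow> m = n"
    and "\<And>x. (\<And>v. v \<in> V \<Longrightarrow> x v \<in> S v) \<Longrightarrow> (\<Sum>m\<in>M. c m * (\<Prod>v\<in>V. x v ^ m v)) = 0"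
    and "m \<in> M"
  shows "c m = 0"
  using assms
proof (induction V arbitrary: M m rule: finite_induct)
  case empty
  then have "M = {m}" by blast
  with empty.prems(4) show ?case by simp
next
  case (insert v V)
  let ?N = "\<lambda>n. {m \<in> M. m v = n}"
  show ?case
  proof (rule insert.IH)
    show "finite (?N (m v))" using insert.prems(1) by simp
    show "m \<in> ?N (m v)" using insert.prems by simp
    show "infinite (S u)" if "u \<in> V" for u using insert.prems(2) that by simp
    show "a = b" if "a \<in> ?N (m v)" "b \<in> ?N (m v)" "\<And>u. u \<in> V \<Longrightarrow> a u = b u" for a b
      by (rule insert.prems(3)) (use that in auto)
    show "(\<Sum>k\<in>?N (m v). c k * (\<Prod>u\<in>V. x u ^ k u)) = 0" if x: "\<And>u. u \<in> V \<Longrightarrow> x u \<in> S u" for x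
    proof -
      define a where "a n = (\<Sum>k\<in>?N n. c k * (\<Prod>u\<in>V. x u ^ k u))" for n
      define P where "P = (\<Sum>n\<in>(\<lambda>k. k v) ` M. Polynomial.monom (a n) n)"
      have "poly P t = 0" if t: "t \<in> S v" for t
      proof -
        have "poly P t = (\<Sum>n\<in>(\<lambda>k. k v) ` M. \<Sum>k\<in>?N n. c k * (t ^ k v * (\<Prod>u\<in>V. x u ^ k u)))"
          unfolding P_def poly_sum poly_monom a_def sum_distrib_right
          by (intro sum.cong refl) (simp add: algebra_simps)
        also have "\<dots> = (\<Sum>k\<in>M. c k * (t ^ k v * (\<Prod>u\<in>V. x u ^ k u)))"
          using sum.image_gen[OF insert.prems(1), of "\<lambda>k. c k * (t ^ k v * (\<Prod>u\<in>V. x u ^ k u))" "\<lambda>k. k v"]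
          by simp
        also have "\<dots> = (\<Sum>k\<in>M. c k * (\<Prod>u\<in>insert v V. (x(v := t)) u ^ k u))"
        proof -
          have "(\<Prod>u\<in>V. (x(v := t)) u ^ k u) = (\<Prod>u\<in>V. x u ^ k u)" for k
            by (rule prod.cong) (use insert.hyps in auto)
          then show ?thesis using insert.hyps by simp
        qed
        also have "\<dots> = 0"
          by (rule insert.prems(4)) (use x t insert.hyps in auto)
        finally show ?thesis .
      qed
      then have "S v \<subseteq> {t. poly P t = 0}" by blast
      moreover have "infinite (S v)" using insert.prems(2) by simp
      ultimately have "P = 0" using poly_roots_finite finite_subset by blast
      then have "Polynomial.coeff P (m v) = 0" by simp
      moreover have "Polynomial.coeff P (m v) = a (m v)"
        using insert.prems(1,5) by (auto simp: P_def coeff_sum sum.delta)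
      ultimately show ?thesis by (simp add: a_def)
    qed
  qed
qed

text \<open>Asking for zeros only on a product of infinite sets is what later lets a small box of
  generator values prove algebraic independence.\<close>

lemma meval_identity:
  fixes p :: "'v mpoly" and S :: "'v \<Rightarrow> real set"
  assumes fin: "finite (UNIV :: 'v set)"
    and S: "\<And>v. infinite (S v)" and z: "\<And>x. (\<And>v. x v \<in> S v) \<Longrightarrow> meval p x = 0"
  shows "p = 0"
proof -
  let ?l = "Poly_Mapping.lookup :: ('v \<Rightarrow>\<^sub>0 nat) \<Rightarrow> _"
  \<comment> \<open>\<open>Abs_poly_mapping\<close> undoes \<open>lookup\<close>, so
    \<open>?c\<close> reads a coefficient of \<open>p\<close> off the exponent function of its
    monomial.\<close>
  let ?c = "\<lambda>k. Poly_Mapping.lookup p (Abs_poly_mapping k)"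
  have "Poly_Mapping.lookup p m = 0" if "m \<in> Poly_Mapping.keys p" for m
  proof -
    have "?c (?l m) = 0"
    proof (rule multivariate_identity_coeff[where V = UNIV and M = "?l ` Poly_Mapping.keys p" and S = S])
      show "(\<Sum>k\<in>?l ` Poly_Mapping.keys p. ?c k * (\<Prod>v\<in>UNIV. x v ^ k v)) = 0"
        if "\<And>v. v \<in> UNIV \<Longrightarrow> x v \<in> S v" for x
      proof -
        have "(\<Sum>k\<in>?l ` Poly_Mapping.keys p. ?c k * (\<Prod>v\<in>UNIV. x v ^ k v))
            = (\<Sum>k\<in>Poly_Mapping.keys p. Poly_Mapping.lookup p k * (\<Prod>v\<in>UNIV. x v ^ ?l k v))"
          by (subst sum.reindex) (auto simp: inj_on_def poly_mapping_eqI)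
        also have "\<dots> = meval p x"
          by (simp add: meval_def monom_eval_superset[OF fin])
        finally show ?thesis using z that by simp
      qed
    qed (use fin S that in auto)
    then show ?thesis by simp
  qed
  then show ?thesis by (metis in_keys_iff poly_mapping_eqI lookup_zero)
qed

section \<open>Diagonalisation\<close>

definition diag3 :: "real \<Rightarrow> real \<Rightarrow> real \<Rightarrow> bloch" where
  "diag3 a b c = vector [vector [a, 0, 0], vector [0, b, 0], vector [0, 0, c]]"

lemmas matrix3_simps = vec_eq_iff forall_3 matrix_matrix_mult_def transpose_def sum_3 mat_def

lemma SO3_I:
  fixes R :: "real^3^3"
  assumes "transpose R ** R = mat 1" "det R = 1"
  shows "R \<in> SO3"
  using assms by (simp add: SO3_def rotation_matrix_def orthogonal_matrix)

lemma SO3_mult: "A \<in> SO3 \<Longrightarrow> B \<in> SO3 \<Longrightarrow> A ** B \<in> SO3"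
  by (simp add: SO3_def rotation_matrix_def orthogonal_matrix_mul det_mul)

lemma SO3_one: "mat 1 \<in> SO3"
  by (simp add: SO3_def rotation_matrix_def orthogonal_matrix_id)

lemma SO3_transpose_mult: "R \<in> SO3 \<Longrightarrow> transpose R ** R = mat 1"
  by (simp add: SO3_def rotation_matrix_def orthogonal_matrix_def)

text \<open>Rows of a rotation are unit vectors, and the defining equations are polynomial.
  Compactness provides the maximum used in \<open>singular_value_decomposition\<close>.\<close>

lemma compact_SO3: "compact SO3"
proof -
  have "bounded SO3"
  proof (rule boundedI)
    fix R :: "real^3^3" assume "R \<in> SO3"
    then have "norm (R $ i) = 1" for i
      by (simp add: SO3_def rotation_matrix_def orthogonal_matrix_orthonormal_rows row_def)
    then show "norm R \<le> 3"
      using norm_le_l1_cart[of "\<chi> i. norm (R $ i)"]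
      by (simp add: norm_vec_def sum_3)
  qed
  moreover have "closed SO3"
  proof -
    have "closed {R :: real^3^3. transpose R ** R = mat 1}"
      by (intro closed_Collect_eq) (auto simp: matrix_matrix_mult_def transpose_def intro!: continuous_intros)
    moreover have "closed {R :: real^3^3. det R = 1}"
      by (intro closed_Collect_eq) (auto simp: det_3 intro!: continuous_intros)
    ultimately have "closed ({R :: real^3^3. transpose R ** R = mat 1} \<inter> {R. det R = 1})"
      by (rule closed_Int)
    moreover have "{R. transpose R ** R = mat 1} \<inter> {R. det R = 1} = SO3"
      by (auto simp: SO3_def rotation_matrix_def orthogonal_matrix)
    ultimately show ?thesis by metis
  qed
  ultimately show ?thesis by (simp add: compact_eq_bounded_closed)
qed

text \<open>At the point (A, B) / r of the circle the linear form takes the value \<open>r\<close>,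
  and \<open>r \<le> A\<close> forces \<open>B = 0\<close>. This stands in for differentiating along
  a plane rotation.\<close>

lemma linear_max_on_circle:
  fixes A B :: real
  assumes "\<And>c s. c\<^sup>2 + s\<^sup>2 = 1 \<Longrightarrow> c * A + s * B \<le> A"
  shows "B = 0"
proof (rule ccontr)
  assume "B \<noteq> 0"
  define r where "r = sqrt (A\<^sup>2 + B\<^sup>2)"
  have r2: "r\<^sup>2 = A\<^sup>2 + B\<^sup>2" by (simp add: r_def)
  have r: "r > 0" using \<open>B \<noteq> 0\<close> by (simp add: r_def add_nonneg_pos)
  have "(A / r) * A + (B / r) * B \<le> A"
    by (rule assms) (use r r2 \<open>B \<noteq> 0\<close> in \<open>simp add: power_divide add_divide_distrib[symmetric]\<close>)
  moreover have "(A / r) * A + (B / r) * B = r"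
    using r r2 by (simp add: field_simps power2_eq_square)
  ultimately have "r\<^sup>2 \<le> A\<^sup>2" using r by (simp add: power_mono)
  with r2 \<open>B \<noteq> 0\<close> show False by simp
qed

definition rot12 :: "real \<Rightarrow> real \<Rightarrow> real^3^3" where
  "rot12 c s = vector [vector [c, - s, 0], vector [s, c, 0], vector [0, 0, 1]]"

definition rot13 :: "real \<Rightarrow> real \<Rightarrow> real^3^3" where
  "rot13 c s = vector [vector [c, 0, - s], vector [0, 1, 0], vector [s, 0, c]]"

definition rot23 :: "real \<Rightarrow> real \<Rightarrow> real^3^3" where
  "rot23 c s = vector [vector [1, 0, 0], vector [0, c, - s], vector [0, s, c]]"

lemma rot_SO3:
  assumes "c\<^sup>2 + s\<^sup>2 = 1"
  shows "rot12 c s \<in> SO3" "rot13 c s \<in> SO3" "rot23 c s \<in> SO3"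
  using assms
  by (auto intro!: SO3_I
      simp: rot12_def rot13_def rot23_def matrix3_simps det_3 power2_eq_square algebra_simps)

text \<open>Maximising this functional over \<open>SO3 \<times> SO3\<close> replaces the spectral theorem: since the weights
  are distinct, stationarity under plane rotations on both sides forces both off-diagonal entries
  of each plane to vanish.\<close>

definition weighted_trace :: "bloch \<Rightarrow> real" where
  "weighted_trace M = M $ 1 $ 1 + 2 * M $ 2 $ 2 + 3 * M $ 3 $ 3"

lemma diagonal_if_weighted_trace_max:
  assumes L: "\<And>G. G \<in> SO3 \<Longrightarrow> weighted_trace (G ** M) \<le> weighted_trace M"
    and R: "\<And>G. G \<in> SO3 \<Longrightarrow> weighted_trace (M ** transpose G) \<le> weighted_trace M"
  shows "M = diag3 (M $ 1 $ 1) (M $ 2 $ 2) (M $ 3 $ 3)"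
proof -
  note s = weighted_trace_def rot12_def rot13_def rot23_def matrix_matrix_mult_def transpose_def sum_3
  \<comment> \<open>For i < j, a left rotation of the (i, j) plane turns the weighted trace into c *
    A + s * (j * M_ij - i * M_ji) plus a constant; a right rotation does the same with M_ij and M_ji
    exchanged. The two resulting linear equations have determinant j^2 - i^2, which is
    nonzero.\<close>
  have 1: "2 * M $ 1 $ 2 - M $ 2 $ 1 = 0"
    by (rule linear_max_on_circle[where A = "M $ 1 $ 1 + 2 * M $ 2 $ 2"])
      (use L[OF rot_SO3(1)] in \<open>simp add: s algebra_simps\<close>)
  have 2: "2 * M $ 2 $ 1 - M $ 1 $ 2 = 0"
    by (rule linear_max_on_circle[where A = "M $ 1 $ 1 + 2 * M $ 2 $ 2"])
      (use R[OF rot_SO3(1)] in \<open>simp add: s algebra_simps\<close>)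
  have 3: "3 * M $ 1 $ 3 - M $ 3 $ 1 = 0"
    by (rule linear_max_on_circle[where A = "M $ 1 $ 1 + 3 * M $ 3 $ 3"])
      (use L[OF rot_SO3(2)] in \<open>simp add: s algebra_simps\<close>)
  have 4: "3 * M $ 3 $ 1 - M $ 1 $ 3 = 0"
    by (rule linear_max_on_circle[where A = "M $ 1 $ 1 + 3 * M $ 3 $ 3"])
      (use R[OF rot_SO3(2)] in \<open>simp add: s algebra_simps\<close>)
  have 5: "3 * M $ 2 $ 3 - 2 * M $ 3 $ 2 = 0"
    by (rule linear_max_on_circle[where A = "2 * M $ 2 $ 2 + 3 * M $ 3 $ 3"])
      (use L[OF rot_SO3(3)] in \<open>simp add: s algebra_simps\<close>)
  have 6: "3 * M $ 3 $ 2 - 2 * M $ 2 $ 3 = 0"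
    by (rule linear_max_on_circle[where A = "2 * M $ 2 $ 2 + 3 * M $ 3 $ 3"])
      (use R[OF rot_SO3(3)] in \<open>simp add: s algebra_simps\<close>)
  have "M $ 1 $ 2 = 0" "M $ 2 $ 1 = 0" "M $ 1 $ 3 = 0" "M $ 3 $ 1 = 0" "M $ 2 $ 3 = 0" "M $ 3 $ 2 = 0"
    using 1 2 3 4 5 6 by linarith+
  then show ?thesis by (simp add: diag3_def vec_eq_iff forall_3)
qed

text \<open>The orbit of \<open>C\<close> is the image of a compact group, so some
  \<open>act g C\<close> maximises \<open>weighted_trace\<close> on it. Multiplying either factor of
  \<open>g\<close> by a rotation stays in the orbit, so the maximiser is diagonal. Since only
  rotations are allowed, the diagonal entries may have any sign.\<close>

lemma singular_value_decomposition:
  fixes C :: bloch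
  obtains g a b c where "g \<in> SO3 \<times> SO3" "act g C = diag3 a b c"
proof -
  have "continuous_on (SO3 \<times> SO3) (\<lambda>g. weighted_trace (act g C))"
    unfolding weighted_trace_def act_def case_prod_unfold matrix_matrix_mult_def transpose_def vec_lambda_beta
    by (intro continuous_intros)
  moreover have "compact (SO3 \<times> SO3)"
    by (intro compact_Times compact_SO3)
  moreover have "SO3 \<times> SO3 \<noteq> {}"
    using SO3_one by blast
  ultimately have "\<exists>g\<in>SO3 \<times> SO3. \<forall>h\<in>SO3 \<times> SO3. weighted_trace (act h C) \<le> weighted_trace (act g C)"
    by (intro continuous_attains_sup)
  then obtain g where g: "g \<in> SO3 \<times> SO3"
      and max: "\<And>h. h \<in> SO3 \<times> SO3 \<Longrightarrow> weighted_trace (act h C) \<le> weighted_trace (act g C)"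
    by metis
  obtain P Q where PQ: "g = (P, Q)" by force
  have "weighted_trace (G ** act g C) \<le> weighted_trace (act g C)" if "G \<in> SO3" for G
    using max[of "(G ** P, Q)"] g that by (simp add: PQ SO3_mult act_def matrix_mul_assoc)
  moreover have "weighted_trace (act g C ** transpose G) \<le> weighted_trace (act g C)" if "G \<in> SO3" for G
    using max[of "(P, G ** Q)"] g that
    by (simp add: PQ SO3_mult act_def matrix_mul_assoc matrix_transpose_mul)
  ultimately have "act g C = diag3 (act g C $ 1 $ 1) (act g C $ 2 $ 2) (act g C $ 3 $ 3)"
    by (intro diagonal_if_weighted_trace_max)
  with g show ?thesis by (rule that)
qed

section \<open>Invariants on diagonal matrices\<close>

text \<open>The values of the generators at \<open>diag3 a b c\<close>, as
  \<open>gen_fun_diag3\<close> confirms, packaged as an assignment that \<open>meval\<close>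
  accepts.\<close>

definition diag_gens :: "real \<Rightarrow> real \<Rightarrow> real \<Rightarrow> gen \<Rightarrow> real" where
  "diag_gens a b c = (\<lambda>t. case t of T2 \<Rightarrow> a\<^sup>2 + b\<^sup>2 + c\<^sup>2 | T3 \<Rightarrow> a * b * c | T4 \<Rightarrow> a ^ 4 + b ^ 4 + c ^ 4)"

text \<open>Homogeneity is built in, so that the graded statement comes for free from the ungraded argument.\<close>

definition diag_inv :: "nat \<Rightarrow> (real \<Rightarrow> real \<Rightarrow> real \<Rightarrow> real) set" where
  "diag_inv d = {\<phi>. \<exists>q\<in>mhomogeneous gen_deg d. \<forall>a b c. \<phi> a b c = meval q (diag_gens a b c)}"

lemma diag_inv_add:
  "\<phi> \<in> diag_inv d \<Longrightarrow> \<psi> \<in> diag_inv d \<Longrightarrow> (\<lambda>a b c. \<phi> a b c + \<psi> a b c) \<in> diag_inv d"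
  unfolding diag_inv_def mem_Collect_eq by (metis mhomogeneous_add meval_add)

lemma diag_inv_mult:
  "\<phi> \<in> diag_inv d \<Longrightarrow> \<psi> \<in> diag_inv e \<Longrightarrow> (\<lambda>a b c. \<phi> a b c * \<psi> a b c) \<in> diag_inv (d + e)"
  unfolding diag_inv_def mem_Collect_eq by (metis mhomogeneous_mult meval_mult)

lemma diag_inv_const: "(\<lambda>a b c. k) \<in> diag_inv 0"
  unfolding diag_inv_def by (force intro: mhomogeneous_mconst[of k])

lemma diag_inv_scale: "\<phi> \<in> diag_inv d \<Longrightarrow> (\<lambda>a b c. k * \<phi> a b c) \<in> diag_inv d"
  using diag_inv_mult[OF diag_inv_const] by fastforce

lemma diag_inv_zero: "(\<lambda>a b c. 0) \<in> diag_inv d"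
  unfolding diag_inv_def by (force intro: mhomogeneous_zero)

lemma diag_inv_diff:
  "\<phi> \<in> diag_inv d \<Longrightarrow> \<psi> \<in> diag_inv d \<Longrightarrow> (\<lambda>a b c. \<phi> a b c - \<psi> a b c) \<in> diag_inv d"
  using diag_inv_add[OF _ diag_inv_scale[where k = "-1"]] by fastforce

lemma diag_inv_power: "\<phi> \<in> diag_inv d \<Longrightarrow> (\<lambda>a b c. \<phi> a b c ^ n) \<in> diag_inv (n * d)"
  by (induction n) (simp_all add: diag_inv_const diag_inv_mult)

lemma diag_inv_T2: "(\<lambda>a b c. a\<^sup>2 + b\<^sup>2 + c\<^sup>2) \<in> diag_inv 2"
  unfolding diag_inv_def diag_gens_def using mhomogeneous_mvar[of T2 gen_deg]
  by (auto intro!: bexI[of _ "mvar T2"])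

lemma diag_inv_T3: "(\<lambda>a b c. a * b * c) \<in> diag_inv 3"
  unfolding diag_inv_def diag_gens_def using mhomogeneous_mvar[of T3 gen_deg]
  by (auto intro!: bexI[of _ "mvar T3"])

lemma diag_inv_T4: "(\<lambda>a b c. a ^ 4 + b ^ 4 + c ^ 4) \<in> diag_inv 4"
  unfolding diag_inv_def diag_gens_def using mhomogeneous_mvar[of T4 gen_deg]
  by (auto intro!: bexI[of _ "mvar T4"])

section \<open>Symmetric polynomials in the squared diagonal entries\<close>

text \<open>Each of x, y, z is a root of u^3 - e1 u^2 + e2 u - e3; multiplying by u^n and summing
  over the roots gives the recursion. Here e2 is written through power sums, since those are what
  the generators supply.\<close>

lemma newton_identity:
  fixes x y z :: "'a::field_char_0"
  shows "x ^ (n + 3) + y ^ (n + 3) + z ^ (n + 3)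
    = (x + y + z) * (x ^ (n + 2) + y ^ (n + 2) + z ^ (n + 2))
      - ((x + y + z)\<^sup>2 - (x\<^sup>2 + y\<^sup>2 + z\<^sup>2)) / 2 * (x ^ (n + 1) + y ^ (n + 1) + z ^ (n + 1))
      + x * y * z * (x ^ n + y ^ n + z ^ n)"
  by (simp add: power_add power2_eq_square power3_eq_cube field_simps)

text \<open>Newton's recursion applied to the squares, where e1 is \<open>t\<^sub>2\<close>, e2 is
  half of \<open>t\<^sub>2\<^sup>2 - t\<^sub>4\<close>, and e3 is \<open>t\<^sub>3\<^sup>2\<close>.
  The start values are the constant 3, \<open>t\<^sub>2\<close> and
  \<open>t\<^sub>4\<close>.\<close>

lemma diag_inv_power_sum: "(\<lambda>a b c. (a\<^sup>2) ^ n + (b\<^sup>2) ^ n + (c\<^sup>2) ^ n) \<in> diag_inv (2 * n)"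
proof (induction n rule: less_induct)
  case (less n)
  let ?p = "\<lambda>n a b c. (a\<^sup>2) ^ n + (b\<^sup>2) ^ n + (c\<^sup>2) ^ n :: real"
  consider "n = 0" | "n = 1" | "n = 2" | k where "n = k + 3"
    by (metis One_nat_def add.commute add_2_eq_Suc' le_add_diff_inverse less_2_cases linorder_not_less
        less_Suc_eq numeral_3_eq_3 numeral_2_eq_2)
  then show ?case
  proof cases
    case 1 then show ?thesis by (simp add: diag_inv_const)
  next
    case 2 then show ?thesis by (simp add: diag_inv_T2)
  next
    case 3 then show ?thesis using diag_inv_T4 by simp
  next
    case (4 k)
    have e1: "(\<lambda>a b c. (a\<^sup>2 + b\<^sup>2 + c\<^sup>2) * ?p (k + 2) a b c) \<in> diag_inv (2 + 2 * (k + 2))"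
      by (intro diag_inv_mult diag_inv_T2 less) (simp add: 4)
    have s2: "(\<lambda>a b c. (a\<^sup>2 + b\<^sup>2 + c\<^sup>2)\<^sup>2) \<in> diag_inv 4"
      using diag_inv_power[OF diag_inv_T2, of 2] by simp
    have e2: "(\<lambda>a b c. (1/2) * ((a\<^sup>2 + b\<^sup>2 + c\<^sup>2)\<^sup>2 - (a ^ 4 + b ^ 4 + c ^ 4)) * ?p (k + 1) a b c)
        \<in> diag_inv (4 + 2 * (k + 1))"
      by (intro diag_inv_mult diag_inv_scale diag_inv_diff diag_inv_T4 s2 less) (simp add: 4)
    have e3: "(\<lambda>a b c. (a * b * c)\<^sup>2 * ?p k a b c) \<in> diag_inv (2 * 3 + 2 * k)"
      by (intro diag_inv_mult diag_inv_power diag_inv_T3 less) (simp add: 4)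
    \<comment> \<open>All three terms of the recursion have the same weighted degree, so homogeneity
      is preserved.\<close>
    have d: "2 + 2 * (k + 2) = 2 * n" "4 + 2 * (k + 1) = 2 * n" "2 * 3 + 2 * k = 2 * n"
      using 4 by simp_all
    have "?p n = (\<lambda>a b c. (a\<^sup>2 + b\<^sup>2 + c\<^sup>2) * ?p (k + 2) a b c
        - (1/2) * ((a\<^sup>2 + b\<^sup>2 + c\<^sup>2)\<^sup>2 - (a ^ 4 + b ^ 4 + c ^ 4)) * ?p (k + 1) a b c
        + (a * b * c)\<^sup>2 * ?p k a b c)"
      unfolding 4 newton_identity by (intro ext) (simp add: power_mult_distrib flip: power_mult)
    moreover have "\<dots> \<in> diag_inv (2 * n)"
      using e1 e2 e3 unfolding d by (intro diag_inv_add diag_inv_diff)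
    ultimately show ?thesis by simp
  qed
qed

text \<open>All six permutations are summed, so terms repeat when exponents coincide; this avoids
  case distinctions on equal exponents.\<close>

definition sym_monomial :: "nat \<Rightarrow> nat \<Rightarrow> nat \<Rightarrow> real \<Rightarrow> real \<Rightarrow> real \<Rightarrow> real" where
  "sym_monomial i j k x y z = x ^ i * y ^ j * z ^ k + y ^ i * z ^ j * x ^ k + z ^ i * x ^ j * y ^ k
    + y ^ i * x ^ j * z ^ k + x ^ i * z ^ j * y ^ k + z ^ i * y ^ j * x ^ k"

lemma sym_monomial_rotate: "sym_monomial i j k = sym_monomial j k i"
  by (intro ext) (simp add: sym_monomial_def algebra_simps)

text \<open>In the product of the power sums of orders \<open>i\<close> and \<open>j\<close>, the
  terms mixing two different variables form the symmetrised monomial, and the remaining ones form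
  the power sum of order \<open>i + j\<close>.\<close>

lemma diag_inv_sym_monomial_0:
  "(\<lambda>a b c. sym_monomial i j 0 (a\<^sup>2) (b\<^sup>2) (c\<^sup>2)) \<in> diag_inv (2 * (i + j))"
proof -
  let ?p = "\<lambda>n a b c. (a\<^sup>2) ^ n + (b\<^sup>2) ^ n + (c\<^sup>2) ^ n :: real"
  have "(\<lambda>a b c. sym_monomial i j 0 (a\<^sup>2) (b\<^sup>2) (c\<^sup>2)) = (\<lambda>a b c. ?p i a b c * ?p j a b c - ?p (i + j) a b c)"
    by (intro ext) (simp add: sym_monomial_def power_add algebra_simps)
  moreover have "\<dots> \<in> diag_inv (2 * (i + j))"
    using diag_inv_mult[OF diag_inv_power_sum[of i] diag_inv_power_sum[of j]]
      diag_inv_power_sum[of "i + j"]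
    by (intro diag_inv_diff) (simp_all add: distrib_left)
  ultimately show ?thesis by simp
qed

text \<open>A cyclic shift brings the least exponent to the last place; if it is \<open>k\<close>,
  the common factor (abc)^(2k) splits off and leaves exponent 0 there.\<close>

lemma diag_inv_sym_monomial:
  "(\<lambda>a b c. sym_monomial i j k (a\<^sup>2) (b\<^sup>2) (c\<^sup>2)) \<in> diag_inv (2 * (i + j + k))"
proof -
  have *: "(\<lambda>a b c. sym_monomial i j k (a\<^sup>2) (b\<^sup>2) (c\<^sup>2)) \<in> diag_inv (2 * (i + j + k))"
    if "k \<le> i" "k \<le> j" for i j k
  proof -
    define i' j' where "i' = i - k" and "j' = j - k"
    have ij: "i = i' + k" "j = j' + k" using that by (simp_all add: i'_def j'_def)
    have "(\<lambda>a b c. sym_monomial i j k (a\<^sup>2) (b\<^sup>2) (c\<^sup>2))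
        = (\<lambda>a b c. (a * b * c) ^ (2 * k) * sym_monomial i' j' 0 (a\<^sup>2) (b\<^sup>2) (c\<^sup>2))"
      by (intro ext)
        (simp add: ij sym_monomial_def power_add power_mult_distrib algebra_simps flip: power_mult)
    moreover have "\<dots> \<in> diag_inv (2 * k * 3 + 2 * (i' + j'))"
      by (intro diag_inv_mult diag_inv_power diag_inv_T3 diag_inv_sym_monomial_0)
    ultimately show ?thesis by (simp add: ij algebra_simps)
  qed
  consider "k \<le> i" "k \<le> j" | "i \<le> j" "i \<le> k" | "j \<le> i" "j \<le> k" by linarith
  then show ?thesis
  proof cases
    case 1 then show ?thesis by (rule *)
  next
    case 2
    then have "(\<lambda>a b c. sym_monomial j k i (a\<^sup>2) (b\<^sup>2) (c\<^sup>2)) \<in> diag_inv (2 * (j + k + i))"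
      by (intro *)
    then show ?thesis by (simp add: sym_monomial_rotate[of i j k] add_ac)
  next
    case 3
    then have "(\<lambda>a b c. sym_monomial k i j (a\<^sup>2) (b\<^sup>2) (c\<^sup>2)) \<in> diag_inv (2 * (k + i + j))"
      by (intro *)
    then show ?thesis by (simp add: sym_monomial_rotate[of k i j] add_ac)
  qed
qed

section \<open>Averaging over even sign changes and permutations\<close>

text \<open>Only even sign changes occur, since an odd one flips the determinant. Neither this sum
  nor \<open>perm_sum\<close> is normalised, whence the factor 24 in
  \<open>invariant_average\<close>.\<close>

definition sign_sum :: "(real \<Rightarrow> real \<Rightarrow> real \<Rightarrow> real) \<Rightarrow> real \<Rightarrow> real \<Rightarrow> real \<Rightarrow> real" where
  "sign_sum \<phi> a b c = \<phi> a b c + \<phi> a (- b) (- c) + \<phi> (- a) b (- c) + \<phi> (- a) (- b) c"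

definition perm_sum :: "(real \<Rightarrow> real \<Rightarrow> real \<Rightarrow> real) \<Rightarrow> real \<Rightarrow> real \<Rightarrow> real \<Rightarrow> real" where
  "perm_sum \<phi> a b c = \<phi> a b c + \<phi> b c a + \<phi> c a b + \<phi> b a c + \<phi> a c b + \<phi> c b a"

text \<open>The three nontrivial sign changes multiply the monomial by signs whose product is 1.
  They are all 1 exactly when the exponents share a parity; otherwise two of them are -1 and the sum
  cancels.\<close>

lemma sign_sum_monomial:
  "sign_sum (\<lambda>a b c. a ^ i * b ^ j * c ^ k) =
    (if even i = even j \<and> even j = even k then (\<lambda>a b c. 4 * (a ^ i * b ^ j * c ^ k)) else (\<lambda>a b c. 0))"
  by (intro ext) (auto simp: sign_sum_def)

text \<open>If the exponents share the parity \<open>e\<close>, the monomial is (abc)^e times a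
  monomial in the squares, which the permutations symmetrise.\<close>

lemma diag_inv_average_monomial:
  "perm_sum (sign_sum (\<lambda>a b c. a ^ i * b ^ j * c ^ k)) \<in> diag_inv (i + j + k)"
proof (cases "even i = even j \<and> even j = even k")
  case False
  then have "sign_sum (\<lambda>a b c. a ^ i * b ^ j * c ^ k) = (\<lambda>a b c. 0)"
    by (simp only: sign_sum_monomial if_False)
  then show ?thesis using diag_inv_zero by (simp add: perm_sum_def[abs_def])
next
  case True
  define e where "e = i mod 2"
  have e: "j mod 2 = e" "k mod 2 = e"
    using True by (simp_all add: e_def mod2_eq_if)
  define i' j' k' where "i' = i div 2" and "j' = j div 2" and "k' = k div 2"
  have ijk: "i = e + 2 * i'" "j = e + 2 * j'" "k = e + 2 * k'"
    using mod_mult_div_eq[of i 2] mod_mult_div_eq[of j 2] mod_mult_div_eq[of k 2] e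
    by (simp_all add: e_def i'_def j'_def k'_def)
  have "sign_sum (\<lambda>a b c. a ^ i * b ^ j * c ^ k) = (\<lambda>a b c. 4 * (a ^ i * b ^ j * c ^ k))"
    unfolding sign_sum_monomial using True by (rule if_P)
  then have "perm_sum (sign_sum (\<lambda>a b c. a ^ i * b ^ j * c ^ k))
      = (\<lambda>a b c. 4 * ((a * b * c) ^ e * sym_monomial i' j' k' (a\<^sup>2) (b\<^sup>2) (c\<^sup>2)))"
    by (simp add: fun_eq_iff perm_sum_def ijk sym_monomial_def power_add power_mult_distrib algebra_simps
        flip: power_mult)
  moreover have "\<dots> \<in> diag_inv (e * 3 + 2 * (i' + j' + k'))"
    by (intro diag_inv_scale diag_inv_mult diag_inv_power diag_inv_T3 diag_inv_sym_monomial)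
  ultimately show ?thesis by (simp add: ijk algebra_simps)
qed

text \<open>The box lies just above the values \<open>(14, 6, 98)\<close> taken at the diagonal matrix with squared
  entries \<open>1, 4, 9\<close>; the squared entries are recovered as roots of a cubic, which exist by the
  intermediate value theorem.\<close>

lemma diag_gens_box:
  assumes "t2 \<in> {14..1401/100}" "t3 \<in> {6..601/100}" "t4 \<in> {98..9801/100}"
  obtains a b c where "diag_gens a b c T2 = t2" "diag_gens a b c T3 = t3" "diag_gens a b c T4 = t4"
proof -
  \<comment> \<open>By Newton, \<open>t2\<close>, \<open>e2\<close> and \<open>t3\<^sup>2\<close>
    have to be the elementary symmetric functions of the squared entries, which makes
    \<open>P\<close> their cubic.\<close>
  define e2 where "e2 = (t2\<^sup>2 - t4) / 2"
  define P where "P u = u ^ 3 - t2 * u\<^sup>2 + e2 * u - t3\<^sup>2" for u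
  have "14\<^sup>2 \<le> t2\<^sup>2" "t2\<^sup>2 \<le> (1401/100)\<^sup>2" "6\<^sup>2 \<le> t3\<^sup>2" "t3\<^sup>2 \<le> (601/100)\<^sup>2"
    using assms by (intro power_mono; simp)+
  then have b: "196 \<le> t2\<^sup>2" "t2\<^sup>2 \<le> 196.3" "36 \<le> t3\<^sup>2" "t3\<^sup>2 \<le> 36.2"
    by (simp_all add: power2_eq_square)
  have t: "14 \<le> t2" "t2 \<le> 1401/100" "6 \<le> t3" "98 \<le> t4" "t4 \<le> 9801/100"
    using assms by simp_all
  \<comment> \<open>At the lower corner of the box the cubic is (u - 1)(u - 4)(u - 9). The points 0,
    2, 6, 10 separate its roots, and the box is narrow enough to keep the signs there.\<close>
  have P: "P 0 < 0" "P 2 > 0" "P 6 < 0" "P 10 > 0"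
  proof -
    have "P 0 = - t3\<^sup>2" "P 2 = 8 - 4 * t2 + t2\<^sup>2 - t4 - t3\<^sup>2"
      "P 6 = 216 - 36 * t2 + 3 * t2\<^sup>2 - 3 * t4 - t3\<^sup>2"
      "P 10 = 1000 - 100 * t2 + 5 * t2\<^sup>2 - 5 * t4 - t3\<^sup>2"
      by (simp_all add: P_def e2_def field_simps)
    then show "P 0 < 0" "P 2 > 0" "P 6 < 0" "P 10 > 0"
      using b t by linarith+
  qed
  have cont: "continuous_on S P" for S
    unfolding P_def by (intro continuous_intros)
  obtain x where x: "0 \<le> x" "x \<le> 2" "P x = 0"
    using IVT'[of P 0 0 2] P cont by force
  obtain y where y: "2 \<le> y" "y \<le> 6" "P y = 0"
    using IVT2'[of P 6 0 2] P cont by force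
  obtain z where z: "6 \<le> z" "z \<le> 10" "P z = 0"
    using IVT'[of P 6 0 10] P cont by force
  have ne: "x \<noteq> y" "y \<noteq> z" "x \<noteq> z" using x y z P by force+
  \<comment> \<open>Vieta's relations by divided differences: dividing out differences of distinct
    roots, first once and then again, leaves the linear relation for the sum of the roots.\<close>
  have "(x - y) * (x\<^sup>2 + x * y + y\<^sup>2 - t2 * (x + y) + e2) = P x - P y"
    "(y - z) * (y\<^sup>2 + y * z + z\<^sup>2 - t2 * (y + z) + e2) = P y - P z"
    by (simp_all add: P_def power2_eq_square power3_eq_cube algebra_simps)
  then have q: "x\<^sup>2 + x * y + y\<^sup>2 - t2 * (x + y) + e2 = 0" "y\<^sup>2 + y * z + z\<^sup>2 - t2 * (y + z) + e2 = 0"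
    using x y z ne by simp_all
  have "(x - z) * (x + y + z - t2) = 0"
    using q by (simp add: power2_eq_square algebra_simps)
  then have s1: "t2 = x + y + z" using ne by simp
  have s2: "e2 = x * y + y * z + z * x"
    using q(1) unfolding s1 by (simp add: power2_eq_square algebra_simps)
  have s3: "t3\<^sup>2 = x * y * z"
    using x(3) unfolding P_def s1 s2 by (simp add: power2_eq_square power3_eq_cube algebra_simps)
  have t4: "t4 = x\<^sup>2 + y\<^sup>2 + z\<^sup>2"
    using s2 unfolding e2_def s1 by (simp add: power2_eq_square algebra_simps)
  \<comment> \<open>The box keeps \<open>t3\<close> positive, so the nonnegative root of
    \<open>t3\<^sup>2\<close> is \<open>t3\<close> itself.\<close>
  have "sqrt x * sqrt y * sqrt z = t3"
    using assms s3 by (simp flip: real_sqrt_mult) (metis s3 real_sqrt_abs abs_of_nonneg atLeastAtMost_iff order_trans zero_le_numeral)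
  moreover have "sqrt u ^ 4 = u\<^sup>2" if "0 \<le> u" for u
    using that power_mult[of "sqrt u" 2 2] by simp
  ultimately show ?thesis
    using that[of "sqrt x" "sqrt y" "sqrt z"] x y z s1 t4 by (simp add: diag_gens_def)
qed

lemma diag_gens_algebraically_independent:
  assumes "\<And>a b c. meval q (diag_gens a b c) = 0"
  shows "q = 0"
proof -
  let ?S = "\<lambda>t. case t of T2 \<Rightarrow> {14..1401/100} | T3 \<Rightarrow> {6..601/100} | T4 \<Rightarrow> {98..9801/100::real}"
  have fin: "finite (UNIV :: gen set)"
  proof (rule finite_subset)
    show "UNIV \<subseteq> {T2, T3, T4}"
    proof
      show "t \<in> {T2, T3, T4}" for t by (cases t) simp_all
    qed
  qed simp
  show ?thesis
  proof (rule meval_identity[OF fin, where S = ?S])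
    show "infinite (?S v)" for v by (cases v) (simp_all add: infinite_Icc)
  next
    fix x assume x: "\<And>v. x v \<in> ?S v"
    obtain a b c where "diag_gens a b c T2 = x T2" "diag_gens a b c T3 = x T3" "diag_gens a b c T4 = x T4"
      by (rule diag_gens_box[of "x T2" "x T3" "x T4"]) (use x[of T2] x[of T3] x[of T4] in simp_all)
    then have "x t = diag_gens a b c t" for t
      by (cases t) simp_all
    then have "x = diag_gens a b c" ..
    then show "meval q x = 0" using assms by simp
  qed
qed

section \<open>The ring of invariants\<close>

text \<open>The right factor cancels in the Gram matrix \<open>C ** transpose C\<close>, which is
  thus only conjugated by \<open>P\<close>; traces of its powers do not change. The determinant is
  multiplied by det P and det Q, both 1.\<close>

lemma gen_fun_act:
  assumes "g \<in> SO3 \<times> SO3"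
  shows "gen_fun t (act g C) = gen_fun t C"
proof -
  obtain P Q where g: "g = (P, Q)" "P \<in> SO3" "Q \<in> SO3" using assms by force
  let ?S = "C ** transpose C"
  have Q: "M ** transpose Q ** Q = M" for M :: "real^3^3"
    using SO3_transpose_mult[OF g(3)] by (simp flip: matrix_mul_assoc)
  have P: "M ** transpose P ** P = M" for M :: "real^3^3"
    using SO3_transpose_mult[OF g(2)] by (simp flip: matrix_mul_assoc)
  have gram: "act g C ** transpose (act g C) = P ** ?S ** transpose P"
    by (simp add: g(1) act_def matrix_transpose_mul matrix_mul_assoc Q)
  have tr: "trace (P ** M ** transpose P) = trace M" for M :: "real^3^3"
    using trace_mul_sym[of "P ** M" "transpose P"] SO3_transpose_mult[OF g(2)]
    by (simp add: matrix_mul_assoc)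
  have sq: "(P ** ?S ** transpose P) ** (P ** ?S ** transpose P) = P ** (?S ** ?S) ** transpose P"
    by (simp add: matrix_mul_assoc P)
  show ?thesis
  proof (cases t)
    case T2
    then show ?thesis by (simp add: gram tr)
  next
    case T3
    then show ?thesis using g by (simp add: act_def det_mul SO3_def rotation_matrix_def)
  next
    case T4
    then show ?thesis by (simp only: gen_fun.simps gram sq tr)
  qed
qed

lemma gen_fun_diag3: "gen_fun t (diag3 a b c) = diag_gens a b c t"
  by (cases t) (simp_all add: diag3_def diag_gens_def trace_def matrix_matrix_mult_def transpose_def
      sum_3 det_3 power2_eq_square power4_eq_xxxx)

section \<open>Degrees of polynomial functions and of the generators\<close>

lemma polynomial_functions_deg_add:
  "f \<in> polynomial_functions_deg d \<Longrightarrow> g \<in> polynomial_functions_deg d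
    \<Longrightarrow> (\<lambda>C. f C + g C) \<in> polynomial_functions_deg d"
  by (auto simp: polynomial_functions_deg_def meval_add[symmetric] intro!: mhomogeneous_add)

lemma polynomial_functions_deg_mult:
  "f \<in> polynomial_functions_deg d \<Longrightarrow> g \<in> polynomial_functions_deg e
    \<Longrightarrow> (\<lambda>C. f C * g C) \<in> polynomial_functions_deg (d + e)"
  by (auto simp: polynomial_functions_deg_def meval_mult[symmetric] intro!: mhomogeneous_mult)

lemma polynomial_functions_deg_const: "(\<lambda>C. k) \<in> polynomial_functions_deg 0"
  unfolding polynomial_functions_deg_def
  by (rule image_eqI[of _ _ "mconst k"]) (simp_all add: mhomogeneous_mconst)

lemma polynomial_functions_deg_zero: "(\<lambda>C. 0) \<in> polynomial_functions_deg d"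
  unfolding polynomial_functions_deg_def
  by (rule image_eqI[of _ _ 0]) (simp_all add: mhomogeneous_zero)

lemma polynomial_functions_deg_entry: "(\<lambda>C. C $ i $ j) \<in> polynomial_functions_deg 1"
  unfolding polynomial_functions_deg_def
  by (rule image_eqI[of _ _ "mvar (i, j)"]) (use mhomogeneous_mvar[of _ "\<lambda>_. 1"] in \<open>auto simp: entries_def\<close>)

lemma polynomial_functions_deg_sum:
  "(\<And>i. i \<in> A \<Longrightarrow> f i \<in> polynomial_functions_deg d) \<Longrightarrow> (\<lambda>C. \<Sum>i\<in>A. f i C) \<in> polynomial_functions_deg d"
  by (induction A rule: infinite_finite_induct)
     (auto intro: polynomial_functions_deg_zero polynomial_functions_deg_add)

lemma polynomial_functions_deg_uminus:
  "f \<in> polynomial_functions_deg d \<Longrightarrow> (\<lambda>C. - f C) \<in> polynomial_functions_deg d"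
  using polynomial_functions_deg_mult[OF polynomial_functions_deg_const[of "-1"]] by fastforce

lemma polynomial_functions_deg_diff:
  "f \<in> polynomial_functions_deg d \<Longrightarrow> g \<in> polynomial_functions_deg d
    \<Longrightarrow> (\<lambda>C. f C - g C) \<in> polynomial_functions_deg d"
  using polynomial_functions_deg_add[OF _ polynomial_functions_deg_uminus] by fastforce

lemma polynomial_functions_deg_power:
  "f \<in> polynomial_functions_deg d \<Longrightarrow> (\<lambda>C. f C ^ n) \<in> polynomial_functions_deg (d * n)"
  by (induction n) (simp_all add: polynomial_functions_deg_const polynomial_functions_deg_mult)

lemma polynomial_functions_deg_prod:
  "(\<And>i. i \<in> A \<Longrightarrow> f i \<in> polynomial_functions_deg (d i))
    \<Longrightarrow> (\<lambda>C. \<Prod>i\<in>A. f i C) \<in> polynomial_functions_deg (\<Sum>i\<in>A. d i)"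
  by (induction A rule: infinite_finite_induct)
     (auto intro: polynomial_functions_deg_const polynomial_functions_deg_mult)

lemma gen_fun_deg: "gen_fun t \<in> polynomial_functions_deg (gen_deg t)"
proof -
  have gram: "(\<lambda>C. (C ** transpose C) $ i $ j) \<in> polynomial_functions_deg 2" for i j
    unfolding matrix_matrix_mult_def transpose_def vec_lambda_beta
    using polynomial_functions_deg_mult[OF polynomial_functions_deg_entry polynomial_functions_deg_entry]
    by (intro polynomial_functions_deg_sum) (simp add: numeral_2_eq_2)
  have gram2: "(\<lambda>C. ((C ** transpose C) ** (C ** transpose C)) $ i $ j) \<in> polynomial_functions_deg 4" for i j
  proof -
    have "((C ** transpose C) ** (C ** transpose C)) $ i $ j
        = (\<Sum>k\<in>UNIV. (C ** transpose C) $ i $ k * (C ** transpose C) $ k $ j)" for C :: bloch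
      by (simp add: matrix_matrix_mult_def[of "C ** transpose C"])
    then show ?thesis
      using polynomial_functions_deg_mult[OF gram gram] by (auto intro!: polynomial_functions_deg_sum)
  qed
  have e3: "(\<lambda>C. C $ i $ j * C $ k $ l * C $ m $ n) \<in> polynomial_functions_deg 3" for i j k l m n
    using polynomial_functions_deg_mult[OF polynomial_functions_deg_mult[OF
        polynomial_functions_deg_entry polynomial_functions_deg_entry] polynomial_functions_deg_entry]
    by (simp add: numeral_3_eq_3 numeral_2_eq_2)
  show ?thesis
  proof (cases t)
    case T2
    have "gen_fun T2 = (\<lambda>C. \<Sum>i\<in>UNIV. (C ** transpose C) $ i $ i)" by (simp add: fun_eq_iff trace_def)
    then show ?thesis using T2 gram by (auto intro!: polynomial_functions_deg_sum)
  next
    case T3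
    have "gen_fun T3 = (\<lambda>C. det C)" by (simp add: fun_eq_iff)
    moreover have "\<dots> \<in> polynomial_functions_deg 3"
      unfolding det_3 by (intro polynomial_functions_deg_add polynomial_functions_deg_diff e3)
    ultimately show ?thesis using T3 by simp
  next
    case T4
    have "gen_fun T4 = (\<lambda>C. \<Sum>i\<in>UNIV. ((C ** transpose C) ** (C ** transpose C)) $ i $ i)"
      by (simp add: fun_eq_iff trace_def)
    then show ?thesis using T4 gram2 by (auto intro!: polynomial_functions_deg_sum)
  qed
qed

text \<open>Substitution turns weighted degree in the generators into ordinary degree in the
  entries. Besides homogeneity, this also yields that \<open>subst_gens p\<close> is polynomial for
  arbitrary \<open>p\<close>.\<close>

lemma subst_gens_monomial_deg:
  "(\<lambda>C. Poly_Mapping.lookup p m * (\<Prod>v\<in>Poly_Mapping.keys m. gen_fun v C ^ Poly_Mapping.lookup m v))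
    \<in> polynomial_functions_deg (\<Sum>v\<in>Poly_Mapping.keys m. gen_deg v * Poly_Mapping.lookup m v)"
  using polynomial_functions_deg_mult[OF polynomial_functions_deg_const polynomial_functions_deg_prod[of
      "Poly_Mapping.keys m", OF polynomial_functions_deg_power[OF gen_fun_deg]]]
  by simp

lemma subst_gens_deg:
  assumes "p \<in> mhomogeneous gen_deg d"
  shows "subst_gens p \<in> polynomial_functions_deg d"
  unfolding subst_gens_def meval_def
proof (rule polynomial_functions_deg_sum)
  fix m assume "m \<in> Poly_Mapping.keys p"
  then have "(\<Sum>v\<in>Poly_Mapping.keys m. gen_deg v * Poly_Mapping.lookup m v) = d"
    using assms by (simp add: mhomogeneous_def)
  then show "(\<lambda>C. Poly_Mapping.lookup p m * (\<Prod>v\<in>Poly_Mapping.keys m. gen_fun v C ^ Poly_Mapping.lookup m v))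
    \<in> polynomial_functions_deg d"
    using subst_gens_monomial_deg[of p m] by simp
qed

lemma polynomial_functions_deg_subset: "polynomial_functions_deg d \<subseteq> polynomial_functions"
  by (auto simp: polynomial_functions_deg_def polynomial_functions_def)

lemma subst_gens_invariant: "subst_gens p \<in> invariants"
proof -
  have "subst_gens p \<in> polynomial_functions"
    unfolding subst_gens_def meval_def
    using subst_gens_monomial_deg polynomial_functions_deg_subset
    by (intro polynomial_functions_sum) blast
  then show ?thesis by (simp add: invariants_def subst_gens_def gen_fun_act)
qed

section \<open>Averaging an invariant along the diagonal\<close>

text \<open>A 3-cycle, a transposition and one even sign change generate the whole symmetry group of
  order 24, and each is realised by a pair of rotations.\<close>

lemma invariant_diag3:
  assumes "f \<in> invariants"
  shows "f (diag3 b c a) = f (diag3 a b c)" "f (diag3 b a c) = f (diag3 a b c)"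
    "f (diag3 a (- b) (- c)) = f (diag3 a b c)"
proof -
  have inv: "f (act (P, Q) C) = f C" if "P \<in> SO3" "Q \<in> SO3" for P Q C
    using assms that by (auto simp: invariants_def)
  define Z :: "real^3^3" where "Z = vector [vector [0, 1, 0], vector [0, 0, 1], vector [1, 0, 0]]"
  \<comment> \<open>A plain transposition matrix has determinant -1. The entry -1 corrects this and
    cancels because \<open>T\<close> acts on both sides; \<open>D\<close> below acts on the left
    only, so its signs survive.\<close>
  define T :: "real^3^3" where "T = vector [vector [0, 1, 0], vector [1, 0, 0], vector [0, 0, -1]]"
  define D :: "real^3^3" where "D = diag3 1 (-1) (-1)"
  have "Z \<in> SO3" "T \<in> SO3" "D \<in> SO3"
    by (rule SO3_I; simp add: Z_def T_def D_def diag3_def matrix3_simps det_3)+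
  moreover have "act (Z, Z) (diag3 a b c) = diag3 b c a" "act (T, T) (diag3 a b c) = diag3 b a c"
    "act (D, mat 1) (diag3 a b c) = diag3 a (- b) (- c)"
    by (simp_all add: act_def Z_def T_def D_def diag3_def matrix3_simps)
  ultimately show "f (diag3 b c a) = f (diag3 a b c)" "f (diag3 b a c) = f (diag3 a b c)"
    "f (diag3 a (- b) (- c)) = f (diag3 a b c)"
    using inv SO3_one by metis+
qed

lemma invariant_average:
  assumes "f \<in> invariants"
  shows "perm_sum (sign_sum (\<lambda>a b c. f (diag3 a b c))) a b c = 24 * f (diag3 a b c)"
proof -
  note i = invariant_diag3[OF assms]
  \<comment> \<open>The other two even sign changes are conjugates of the known one by
    permutations.\<close>
  have s: "f (diag3 (- a) b (- c)) = f (diag3 a b c)" "f (diag3 (- a) (- b) c) = f (diag3 a b c)" for a b c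
    using i by metis+
  have "f (diag3 c a b) = f (diag3 a b c)" "f (diag3 a c b) = f (diag3 a b c)" "f (diag3 c b a) = f (diag3 a b c)"
    using i by metis+
  then show ?thesis by (simp add: perm_sum_def sign_sum_def i s)
qed

lemma invariant_determined_by_diag3:
  assumes "f \<in> invariants" "h \<in> invariants" "\<And>a b c. f (diag3 a b c) = h (diag3 a b c)"
  shows "f = h"
proof
  fix C
  obtain g a b c where g: "g \<in> SO3 \<times> SO3" "act g C = diag3 a b c"
    by (rule singular_value_decomposition)
  have "f C = f (act g C)" "h (act g C) = h C"
    using g(1) assms(1,2) by (auto simp: invariants_def)
  then show "f C = h C" using assms(3) g(2) by simp
qed

lemma prod_3: "prod f (UNIV :: 3 set) = f 1 * f 2 * f 3"
  for f :: "3 \<Rightarrow> 'a::comm_monoid_mult"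
  unfolding UNIV_3 by (simp add: ac_simps)

text \<open>Off-diagonal entries of \<open>diag3 a b c\<close> are zero, so \<open>k\<close> is 0 to
  the power of the total off-diagonal exponent: it is 1 if that exponent is 0 and 0 otherwise. Only
  in the latter case may the degree differ.\<close>

lemma monomial_diag3:
  fixes m :: "3 \<times> 3 \<Rightarrow>\<^sub>0 nat"
  obtains k i j l where
    "\<And>a b c. (\<Prod>v\<in>Poly_Mapping.keys m. entries (diag3 a b c) v ^ Poly_Mapping.lookup m v)
      = k * (a ^ i * b ^ j * c ^ l)"
    "k = 0 \<or> i + j + l = (\<Sum>v\<in>Poly_Mapping.keys m. 1 * Poly_Mapping.lookup m v)"
proof
  let ?l = "Poly_Mapping.lookup m"
  let ?n = "?l (1,2) + ?l (1,3) + ?l (2,1) + ?l (2,3) + ?l (3,1) + ?l (3,2)"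
  have fin: "finite (UNIV :: (3 \<times> 3) set)" by (rule finite_class.finite_UNIV)
  have prod: "(\<Prod>v\<in>UNIV. g v) = (\<Prod>i\<in>UNIV. \<Prod>j\<in>UNIV. g (i, j))" for g :: "3 \<times> 3 \<Rightarrow> real"
    by (simp add: prod.cartesian_product)
  have sum: "(\<Sum>v\<in>UNIV. g v) = (\<Sum>i\<in>UNIV. \<Sum>j\<in>UNIV. g (i, j))" for g :: "3 \<times> 3 \<Rightarrow> nat"
    by (simp add: sum.cartesian_product)
  have "(\<Prod>v\<in>Poly_Mapping.keys m. entries (diag3 a b c) v ^ ?l v)
      = (\<Prod>i\<in>UNIV. \<Prod>j\<in>UNIV. entries (diag3 a b c) (i, j) ^ ?l (i, j))" for a b c
    using monom_eval_superset[OF fin subset_UNIV] prod by simp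
  then show "(\<Prod>v\<in>Poly_Mapping.keys m. entries (diag3 a b c) v ^ ?l v)
      = 0 ^ ?n * (a ^ ?l (1,1) * b ^ ?l (2,2) * c ^ ?l (3,3))" for a b c
    by (simp add: prod_3 entries_def diag3_def power_add mult_ac)
  have "(\<Sum>v\<in>Poly_Mapping.keys m. 1 * ?l v) = (\<Sum>i\<in>UNIV. \<Sum>j\<in>UNIV. ?l (i, j))"
    using weighted_degree_superset[OF fin subset_UNIV, of "\<lambda>_. 1" m] sum by simp
  then have "(\<Sum>v\<in>Poly_Mapping.keys m. 1 * ?l v) = ?n + (?l (1,1) + ?l (2,2) + ?l (3,3))"
    by (simp add: sum_3)
  moreover have "(0::real) ^ ?n = 0 \<or> ?n = 0"
    by (cases "?n = 0") (simp_all only: zero_power neq0_conv simp_thms)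
  ultimately show "(0::real) ^ ?n = 0 \<or> ?l (1,1) + ?l (2,2) + ?l (3,3) = (\<Sum>v\<in>Poly_Mapping.keys m. 1 * ?l v)"
    by linarith
qed

text \<open>Averaging is linear, so the factor \<open>k\<close> comes out. When it is 0 the degrees
  need not match, but the zero function lies in every degree.\<close>

lemma diag_inv_average_entries:
  fixes m :: "3 \<times> 3 \<Rightarrow>\<^sub>0 nat"
  shows "perm_sum (sign_sum (\<lambda>a b c. \<Prod>v\<in>Poly_Mapping.keys m. entries (diag3 a b c) v ^ Poly_Mapping.lookup m v))
    \<in> diag_inv (\<Sum>v\<in>Poly_Mapping.keys m. 1 * Poly_Mapping.lookup m v)"
proof -
  obtain k i j l where
    m: "\<And>a b c. (\<Prod>v\<in>Poly_Mapping.keys m. entries (diag3 a b c) v ^ Poly_Mapping.lookup m v)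
      = k * (a ^ i * b ^ j * c ^ l)"
    and d: "k = 0 \<or> i + j + l = (\<Sum>v\<in>Poly_Mapping.keys m. 1 * Poly_Mapping.lookup m v)"
    by (rule monomial_diag3[of m]; rule that; assumption)
  let ?avg = "perm_sum (sign_sum (\<lambda>a b c. a ^ i * b ^ j * c ^ l))"
  have "perm_sum (sign_sum (\<lambda>a b c. k * (a ^ i * b ^ j * c ^ l))) = (\<lambda>a b c. k * ?avg a b c)"
    by (intro ext) (simp only: perm_sum_def sign_sum_def distrib_left)
  moreover have "(\<lambda>a b c. k * ?avg a b c) \<in> diag_inv (\<Sum>v\<in>Poly_Mapping.keys m. 1 * Poly_Mapping.lookup m v)"
  proof (cases "k = 0")
    case True
    then show ?thesis by (simp add: diag_inv_zero)
  next
    case False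
    then show ?thesis using d diag_inv_scale[OF diag_inv_average_monomial[of i j l]] by metis
  qed
  ultimately show ?thesis by (simp only: m)
qed

text \<open>Single monomials of \<open>p\<close> need not be invariant, but their averages are
  expressible in the generators, and averaging the whole of \<open>p\<close> only multiplies it by
  24 on the diagonal. The polynomial \<open>q\<close> is built monomial by monomial without
  reference to \<open>d\<close>, so one choice serves both the ungraded and the graded
  claim.\<close>

lemma invariant_subst_gens:
  fixes p :: "(3 \<times> 3) mpoly"
  assumes inv: "(\<lambda>C. meval p (entries C)) \<in> invariants"
  obtains q where "(\<lambda>C. meval p (entries C)) = subst_gens q"
    "\<And>d. p \<in> mhomogeneous (\<lambda>_. 1) d \<Longrightarrow> q \<in> mhomogeneous gen_deg d"
proof -
  let ?mono = "\<lambda>(m :: 3 \<times> 3 \<Rightarrow>\<^sub>0 nat) a b c.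
    \<Prod>v\<in>Poly_Mapping.keys m. entries (diag3 a b c) v ^ Poly_Mapping.lookup m v"
  let ?deg = "\<lambda>m :: 3 \<times> 3 \<Rightarrow>\<^sub>0 nat. \<Sum>v\<in>Poly_Mapping.keys m. 1 * Poly_Mapping.lookup m v"
  have "\<forall>m. \<exists>q\<in>mhomogeneous gen_deg (?deg m). \<forall>a b c. perm_sum (sign_sum (?mono m)) a b c = meval q (diag_gens a b c)"
    using diag_inv_average_entries unfolding diag_inv_def by blast
  then obtain Q where Q: "\<And>m. Q m \<in> mhomogeneous gen_deg (?deg m)"
      "\<And>m a b c. perm_sum (sign_sum (?mono m)) a b c = meval (Q m) (diag_gens a b c)"
    by metis
  define q where "q = (\<Sum>m\<in>Poly_Mapping.keys p. mconst (Poly_Mapping.lookup p m / 24) * Q m)"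
  show ?thesis
  proof (rule that)
    fix d assume p: "p \<in> mhomogeneous (\<lambda>_. 1) d"
    have "mconst (Poly_Mapping.lookup p m / 24) * Q m \<in> mhomogeneous gen_deg d"
      if "m \<in> Poly_Mapping.keys p" for m
    proof -
      have "?deg m = d" using p that unfolding mhomogeneous_def by blast
      then show ?thesis
        using mhomogeneous_mult[OF mhomogeneous_mconst Q(1)[of m]] by simp
    qed
    then show "q \<in> mhomogeneous gen_deg d" unfolding q_def by (rule mhomogeneous_sum)
  next
    show "(\<lambda>C. meval p (entries C)) = subst_gens q"
    proof (rule invariant_determined_by_diag3[OF inv subst_gens_invariant])
      fix a b c
      have "24 * meval p (entries (diag3 a b c))
          = perm_sum (sign_sum (\<lambda>a b c. \<Sum>m\<in>Poly_Mapping.keys p. Poly_Mapping.lookup p m * ?mono m a b c)) a b c"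
        using invariant_average[OF inv, of a b c] by (simp add: meval_def)
      also have "\<dots> = (\<Sum>m\<in>Poly_Mapping.keys p. Poly_Mapping.lookup p m * perm_sum (sign_sum (?mono m)) a b c)"
        by (simp only: perm_sum_def sign_sum_def distrib_left sum.distrib)
      also have "\<dots> = 24 * meval q (diag_gens a b c)"
        by (simp add: q_def meval_sum meval_mult Q(2) sum_distrib_left)
      finally show "meval p (entries (diag3 a b c)) = subst_gens q (diag3 a b c)"
        by (simp add: subst_gens_def gen_fun_diag3)
    qed
  qed
qed

section \<open>The graded isomorphism\<close>

text \<open>Comparing the two functions on diagonal matrices already makes \<open>p - q\<close> an
  algebraic relation between the generators there.\<close>

lemma inj_subst_gens: "inj subst_gens"
proof (rule injI)
  fix p q assume eq: "subst_gens p = subst_gens q"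
  have "meval p (diag_gens a b c) = meval q (diag_gens a b c)" for a b c
    using fun_cong[OF eq, of "diag3 a b c"] by (simp add: subst_gens_def gen_fun_diag3)
  moreover have "meval p x = meval (p - q) x + meval q x" for x
    by (simp flip: meval_add)
  ultimately have "p - q = 0" by (intro diag_gens_algebraically_independent) simp
  then show "p = q" by simp
qed

lemma range_subst_gens: "range subst_gens = invariants"
proof
  show "range subst_gens \<subseteq> invariants" using subst_gens_invariant by blast
  show "invariants \<subseteq> range subst_gens"
  proof
    fix f assume f: "f \<in> invariants"
    then obtain p :: "(3 \<times> 3) mpoly" where "f = (\<lambda>C. meval p (entries C))"
      unfolding invariants_def polynomial_functions_def by blast
    with f show "f \<in> range subst_gens" by (metis invariant_subst_gens rangeI)
  qed
qed

lemma subst_gens_ring_iso: "subst_gens \<in> ring_iso ring_of_type_algebra invariant_ring"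
  unfolding ring_iso_def ring_hom_def ring_of_type_algebra_def invariant_ring_def bij_betw_def
  using inj_subst_gens range_subst_gens subst_gens_invariant
  by (auto simp: subst_gens_def fun_eq_iff meval_add meval_mult)

text \<open>For the inclusion from right to left, a homogeneous \<open>p\<close> representing the
  invariant is chosen first; \<open>invariant_subst_gens\<close> carries its homogeneity over to the
  preimage.\<close>

lemma subst_gens_graded:
  "subst_gens ` mhomogeneous gen_deg d = invariants \<inter> polynomial_functions_deg d"
proof
  show "subst_gens ` mhomogeneous gen_deg d \<subseteq> invariants \<inter> polynomial_functions_deg d"
    using subst_gens_invariant subst_gens_deg by blast
  show "invariants \<inter> polynomial_functions_deg d \<subseteq> subst_gens ` mhomogeneous gen_deg d"
  proof
    fix f assume f: "f \<in> invariants \<inter> polynomial_functions_deg d"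
    then obtain p :: "(3 \<times> 3) mpoly"
      where "p \<in> mhomogeneous (\<lambda>_. 1) d" "f = (\<lambda>C. meval p (entries C))"
      unfolding polynomial_functions_deg_def by blast
    with f show "f \<in> subst_gens ` mhomogeneous gen_deg d"
      using invariant_subst_gens[of p] by blast
  qed
qed

text \<open>The clauses beyond the ring isomorphism identify it as the substitution of the three
  given generators over the reals and make it respect the grading.\<close>

theorem theorem4p5:
  shows "subst_gens \<in> ring_iso ring_of_type_algebra invariant_ring
    \<and> (\<forall>c. subst_gens (mconst c) = (\<lambda>C. c))
    \<and> subst_gens (mvar T2) = (\<lambda>C. trace (C ** transpose C))
    \<and> subst_gens (mvar T3) = (\<lambda>C. det C)
    \<and> subst_gens (mvar T4) = (\<lambda>C. trace ((C ** transpose C) ** (C ** transpose C)))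
    \<and> (\<forall>d. subst_gens ` mhomogeneous gen_deg d = invariants \<inter> polynomial_functions_deg d)"
  using subst_gens_ring_iso subst_gens_graded by (simp add: subst_gens_def)

end
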